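(* Let $\mathcal{H}$ be an infinite-dimensional separable complex Hilbert space, let $B(z)=\tau\prod_{i=1}^{d}\frac{z+\lambda_i}{1+\overline{\lambda_i}z}$ be a finite Blaschke product with $|\tau|=1$ and $\lambda_1,\dots,\lambda_d\in\mathbb{D}$, let $V$ be an isometry on $\mathcal{H}$, and let $(b_m)_{m=1}^\infty$ be a Blaschke frame for $B$ with isometry $V$ on $\mathcal{H}$. Then $(b_m)_{m=1}^\infty$ is a Parseval frame and its frame operator is the identity operator on $\mathcal{H}$. Moreover, $$f=\sum_{m=1}^{\infty}\langle f,b_m\rangle_{\mathcal{H}}\,b_m\qquad\text{for all } f\in\mathcal{H}.$$
   Context: $\mathbb{D}$ is the open unit disc in $\mathbb{C}$. For an isometry $V$ on $\mathcal{H}$, $B(V^* )$ is defined by the Riesz-Dunford (rational) functional calculus, i.e. $B(V^* )=\tau\prod_{j=1}^{d}(V^*+\lambda_j 1_{\mathcal{H}})(1_{\mathcal{H}}+\overline{\lambda_j}V^* )^{-1}$. A Blaschke frame for $B$ with isometry $V$ on $\mathcal{H}$ is any sequence $(b_m)_{m=1}^\infty$ of the form $b_m=B(V^* )e_m$ for some orthonormal basis $(e_m)_{m=1}^\infty$ of $\mathcal{H}$. A sequence $(x_m)$ in $\mathcal{H}$ is a frame for $\mathcal{H}$ if there are constants $A,C>0$ (frame bounds) with $A\|f\|^2\le\sum_m|\langle f,x_m\rangle|^2\le C\|f\|^2$ for all $f\in\mathcal{H}$; it is a Parseval frame if this holds with $A=C=1$. The frame operator of a frame $(x_m)$ is $\mathfrak{F}:\mathcal{H}\to\mathcal{H}$,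 $\mathfrak{F}f=\sum_{m=1}^\infty\langle f,x_m\rangle_{\mathcal{H}}x_m$. *)

theory Defs
  imports "HOL-Analysis.Analysis"
begin

class complex_vector = real_vector +
  fixes scaleC :: "complex \<Rightarrow> 'a \<Rightarrow> 'a"  (infixr \<open>*\<^sub>C\<close> 75)
  assumes scaleC_add_right: "c *\<^sub>C (x + y) = c *\<^sub>C x + c *\<^sub>C y"
    and scaleC_add_left: "(c + d) *\<^sub>C x = c *\<^sub>C x + d *\<^sub>C x"
    and scaleC_scaleC: "c *\<^sub>C (d *\<^sub>C x) = (c * d) *\<^sub>C x"
    and scaleC_one: "1 *\<^sub>C x = x"
    and scaleR_scaleC: "r *\<^sub>R x = complex_of_real r *\<^sub>C x"

global_interpretation complex_vector: vector_space "scaleC :: complex \<Rightarrow> 'a \<Rightarrow> 'a::complex_vector"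
  by standard (rule scaleC_add_right scaleC_add_left scaleC_scaleC scaleC_one)+

text \<open>The inner product is linear in the first and conjugate-linear in the second argument.
  By \<open>cinner_commute\<close> the number \<open>cinner x x\<close> is real, so taking its real part loses nothing.\<close>

class complex_inner = complex_vector + real_normed_vector +
  fixes cinner :: "'a \<Rightarrow> 'a \<Rightarrow> complex"
  assumes cinner_commute: "cinner x y = cnj (cinner y x)"
    and cinner_add_left: "cinner (x + y) z = cinner x z + cinner y z"
    and cinner_scaleC_left: "cinner (c *\<^sub>C x) y = c * cinner x y"
    and cinner_ge_zero: "0 \<le> Re (cinner x x)"
    and cinner_eq_zero_iff: "cinner x x = 0 \<longleftrightarrow> x = 0"
    and norm_eq_sqrt_cinner: "norm x = sqrt (Re (cinner x x))"

class chilbert_space = complex_inner + complete_space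

definition cfinite_dimensional :: "'a::complex_vector itself \<Rightarrow> bool" where
  "cfinite_dimensional _ \<longleftrightarrow> (\<exists>S :: 'a set. finite S \<and> complex_vector.span S = UNIV)"

definition orthonormal_basis :: "(nat \<Rightarrow> 'a::complex_inner) \<Rightarrow> bool" where
  "orthonormal_basis e \<longleftrightarrow>
     (\<forall>m n. cinner (e m) (e n) = (if m = n then 1 else 0)) \<and>
     closure (complex_vector.span (range e)) = UNIV"

text \<open>An isometry need not be surjective.\<close>

definition hilbert_isometry :: "('a::complex_inner \<Rightarrow> 'a) \<Rightarrow> bool" where
  "hilbert_isometry V \<longleftrightarrow>
     Vector_Spaces.linear scaleC scaleC V \<and> (\<forall>x. norm (V x) = norm x)"

definition cadjoint :: "('a::complex_inner \<Rightarrow> 'a) \<Rightarrow> 'a \<Rightarrow> 'a" where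
  "cadjoint T = (THE S. \<forall>x y. cinner (T x) y = cinner x (S y))"

text \<open>\<open>op_prod F d\<close> is the operator product \<open>F 1 \<circ> \<dots> \<circ> F d\<close>.\<close>

primrec op_prod :: "(nat \<Rightarrow> 'a \<Rightarrow> 'a) \<Rightarrow> nat \<Rightarrow> 'a \<Rightarrow> 'a" where
  "op_prod F 0 = id"
| "op_prod F (Suc d) = op_prod F d \<circ> F (Suc d)"

text \<open>The operator \<open>B(T) = \<tau> \<Prod>\<^sub>j (T + lam\<^sub>j 1) (1 + cnj lam\<^sub>j T)\<^sup>-\<^sup>1\<close>, \<open>1 \<le> j \<le> d\<close>, for the Blaschke product
  \<open>B(z) = \<tau> \<Prod>\<^sub>j (z + lam\<^sub>j) / (1 + cnj lam\<^sub>j z)\<close>. The operator inverse is the function inverse, which is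
  meaningful because \<open>1 + cnj lam\<^sub>j T\<close> is bijective whenever \<open>T\<close> is a contraction and \<open>\<bar>lam\<^sub>j\<bar> < 1\<close>.\<close>

definition blaschke_operator ::
    "complex \<Rightarrow> nat \<Rightarrow> (nat \<Rightarrow> complex) \<Rightarrow> ('a::complex_vector \<Rightarrow> 'a) \<Rightarrow> 'a \<Rightarrow> 'a" where
  "blaschke_operator \<tau> d lam T x =
     \<tau> *\<^sub>C op_prod (\<lambda>j. (\<lambda>y. T y + lam j *\<^sub>C y) \<circ> inv (\<lambda>y. y + cnj (lam j) *\<^sub>C T y)) d x"

definition blaschke_frame ::
    "complex \<Rightarrow> nat \<Rightarrow> (nat \<Rightarrow> complex) \<Rightarrow> ('a::complex_inner \<Rightarrow> 'a) \<Rightarrow> (nat \<Rightarrow> 'a) \<Rightarrow> bool" where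
  "blaschke_frame \<tau> d lam V b \<longleftrightarrow>
     (\<exists>e. orthonormal_basis e \<and> (\<forall>m. b m = blaschke_operator \<tau> d lam (cadjoint V) (e m)))"

definition frame_bounds :: "real \<Rightarrow> real \<Rightarrow> (nat \<Rightarrow> 'a::complex_inner) \<Rightarrow> bool" where
  "frame_bounds A C x \<longleftrightarrow>
     (\<forall>f. summable (\<lambda>m. (cmod (cinner f (x m)))\<^sup>2) \<and>
          A * (norm f)\<^sup>2 \<le> (\<Sum>m. (cmod (cinner f (x m)))\<^sup>2) \<and>
          (\<Sum>m. (cmod (cinner f (x m)))\<^sup>2) \<le> C * (norm f)\<^sup>2)"

definition hilbert_frame :: "(nat \<Rightarrow> 'a::complex_inner) \<Rightarrow> bool" where
  "hilbert_frame x \<longleftrightarrow> (\<exists>A>0. \<exists>C>0. frame_bounds A C x)"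

definition parseval_frame :: "(nat \<Rightarrow> 'a::complex_inner) \<Rightarrow> bool" where
  "parseval_frame x \<longleftrightarrow> hilbert_frame x \<and> frame_bounds 1 1 x"

definition frame_operator :: "(nat \<Rightarrow> 'a::complex_inner) \<Rightarrow> 'a \<Rightarrow> 'a" where
  "frame_operator x f = (\<Sum>m. cinner f (x m) *\<^sub>C x m)"

end

theory Submission
  imports Defs
begin

text \<open>Everything rests on one observation: \<open>B(V\<^sup>*)\<close> is the adjoint of an isometry.  For a single factor
  with parameter \<open>\<lambda>\<close>, the adjoint of \<open>(V\<^sup>* + \<lambda>) (1 + cnj \<lambda> V\<^sup>*)\<^sup>-\<^sup>1\<close> is
  \<open>(V + cnj \<lambda>) (1 + \<lambda> V)\<^sup>-\<^sup>1\<close>, and this is isometric because \<open>\<parallel>V u + cnj \<lambda> u\<parallel> = \<parallel>u + \<lambda> V u\<parallel>\<close> for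
  an isometry \<open>V\<close>: expand both squares (lemma \<open>blaschke_factor_pair\<close>).  Products of adjoints of
  isometries are again adjoints of isometries, so \<open>B(V\<^sup>*) = W\<^sup>*\<close> for some isometry \<open>W\<close>
  (lemma \<open>blaschke_operator_pair\<close>).

  For an orthonormal basis \<open>e\<close> and \<open>b m = W\<^sup>* (e m)\<close> the frame coefficient of \<open>f\<close> at \<open>b m\<close> is then
  the Fourier coefficient of \<open>W f\<close> at \<open>e m\<close>.  Parseval's identity for \<open>e\<close> gives
  \<open>\<Sum>m. \<bar>\<langle>f, b m\<rangle>\<bar>\<^sup>2 = \<parallel>W f\<parallel>\<^sup>2 = \<parallel>f\<parallel>\<^sup>2\<close>, and applying \<open>W\<^sup>*\<close> to the Fourier expansion of \<open>W f\<close>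
  gives \<open>\<Sum>m. \<langle>f, b m\<rangle> b m = W\<^sup>* W f = f\<close>.

  The operator \<open>V\<^sup>*\<close> is constructed from the basis, as \<open>V\<^sup>* y = \<Sum>m. \<langle>y, V (e m)\<rangle> e m\<close>, and
  the inverses exist by Banach's fixed point theorem.\<close>

section \<open>Complex inner product spaces\<close>

lemma cinner_add_right: "cinner x (y + z) = cinner x y + cinner x z"
  by (metis cinner_commute cinner_add_left complex_cnj_add)

lemma cinner_scaleC_right: "cinner x (c *\<^sub>C y) = cnj c * cinner x y"
  by (metis cinner_commute cinner_scaleC_left complex_cnj_mult)

lemma cinner_zero_left [simp]: "cinner 0 y = 0"
  using cinner_add_left[of 0 0 y] by simp

lemma cinner_zero_right [simp]: "cinner x 0 = 0"
  using cinner_add_right[of x 0 0] by simp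

lemma cinner_minus_left: "cinner (- x) y = - cinner x y"
  using cinner_add_left[of x "- x" y] by (simp add: eq_neg_iff_add_eq_0 add.commute)

lemma cinner_minus_right: "cinner x (- y) = - cinner x y"
  using cinner_add_right[of x y "- y"] by (simp add: eq_neg_iff_add_eq_0 add.commute)

lemma cinner_diff_left: "cinner (x - y) z = cinner x z - cinner y z"
  using cinner_add_left[of x "- y" z] by (simp add: cinner_minus_left)

lemma cinner_diff_right: "cinner x (y - z) = cinner x y - cinner x z"
  using cinner_add_right[of x y "- z"] by (simp add: cinner_minus_right)

lemma cinner_sum_left: "cinner (\<Sum>i\<in>A. f i) y = (\<Sum>i\<in>A. cinner (f i) y)"
  by (induction A rule: infinite_finite_induct) (auto simp: cinner_add_left)

lemma cinner_sum_right: "cinner x (\<Sum>i\<in>A. f i) = (\<Sum>i\<in>A. cinner x (f i))"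
  by (induction A rule: infinite_finite_induct) (auto simp: cinner_add_right)

lemma cinner_self: "cinner x x = of_real ((norm x)\<^sup>2)"
proof -
  have "Im (cinner x x) = 0"
    using arg_cong[OF cinner_commute[of x x], of Im] by simp
  then show ?thesis
    by (simp add: norm_eq_sqrt_cinner cinner_ge_zero complex_eq_iff)
qed

lemma norm_add_square: "(norm (x + y :: 'a::complex_inner))\<^sup>2 = (norm x)\<^sup>2 + (norm y)\<^sup>2 + 2 * Re (cinner x y)"
proof -
  have "complex_of_real ((norm (x + y))\<^sup>2) = of_real ((norm x)\<^sup>2) + of_real ((norm y)\<^sup>2) + (cinner x y + cnj (cinner x y))"
    unfolding cinner_self[symmetric] cinner_add_left cinner_add_right
    using cinner_commute[of y x] by simp
  then show ?thesis
    by (simp only: complex_add_cnj flip: of_real_add) (simp only: of_real_eq_iff)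
qed

lemma norm_scaleC: "norm (c *\<^sub>C x :: 'a::complex_inner) = cmod c * norm x"
proof -
  have "complex_of_real ((norm (c *\<^sub>C x))\<^sup>2) = of_real ((cmod c * norm x)\<^sup>2)"
    unfolding cinner_self[symmetric] cinner_scaleC_left cinner_scaleC_right
    by (simp add: cinner_self power_mult_distrib complex_norm_square mult.assoc del: of_real_power)
  then show ?thesis
    by (simp only: of_real_eq_iff) (metis mult_nonneg_nonneg norm_ge_zero power2_eq_imp_eq)
qed

lemma cinner_right_cancel:
  assumes "\<And>x. cinner x y = cinner x z" shows "y = z"
proof -
  have "cinner (y - z) (y - z) = 0"
    using assms[of "y - z"] by (simp add: cinner_diff_right)
  then show ?thesis by (simp add: cinner_eq_zero_iff)
qed

lemma cinner_Cauchy_Schwarz: "cmod (cinner x y) \<le> norm x * norm (y :: 'a::complex_inner)"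
proof (cases "y = 0")
  case False
  define c where "c = cinner x y / of_real ((norm y)\<^sup>2)"
  have y0: "(norm y)\<^sup>2 > 0" using False by simp
  have "0 \<le> (norm (x + (- c) *\<^sub>C y))\<^sup>2" by (rule zero_le_power2)
  also have "\<dots> = (norm x)\<^sup>2 + (cmod c)\<^sup>2 * (norm y)\<^sup>2 - 2 * Re (cnj c * cinner x y)"
    unfolding norm_add_square norm_scaleC cinner_scaleC_right by (simp add: power_mult_distrib)
  also have "cnj c * cinner x y = of_real ((cmod (cinner x y))\<^sup>2 / (norm y)\<^sup>2)"
    by (simp add: c_def complex_norm_square mult.commute del: of_real_power)
  also have "(cmod c)\<^sup>2 * (norm y)\<^sup>2 = (cmod (cinner x y))\<^sup>2 / (norm y)\<^sup>2"
    using y0 by (simp add: c_def norm_divide norm_power norm_mult power_divide power2_eq_square)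
  finally have "(cmod (cinner x y))\<^sup>2 \<le> (norm x * norm y)\<^sup>2"
    using y0 by (simp add: field_simps power_mult_distrib)
  then show ?thesis by (rule power2_le_imp_le) simp
qed simp

lemma bounded_linear_cinner_left: "bounded_linear (\<lambda>x. cinner x (y :: 'a::complex_inner))"
  by (rule bounded_linear_intro[where K = "norm y"])
    (simp_all add: cinner_add_left scaleR_scaleC cinner_scaleC_left cinner_Cauchy_Schwarz scaleR_conv_of_real)

lemma bounded_linear_cinner_right: "bounded_linear (cinner (x :: 'a::complex_inner))"
  by (rule bounded_linear_intro[where K = "norm x"])
    (simp_all add: cinner_add_right scaleR_scaleC cinner_scaleC_right scaleR_conv_of_real
      cinner_Cauchy_Schwarz mult.commute[of "norm _" "norm x"])

section \<open>Orthonormal sequences and bases\<close>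

definition orthonormal_sequence :: "(nat \<Rightarrow> 'a::complex_inner) \<Rightarrow> bool" where
  "orthonormal_sequence e \<longleftrightarrow> (\<forall>m n. cinner (e m) (e n) = (if m = n then 1 else 0))"

lemma norm_sum_orthonormal_square:
  assumes "orthonormal_sequence e" and "finite A"
  shows "(norm (\<Sum>i\<in>A. c i *\<^sub>C e i))\<^sup>2 = (\<Sum>i\<in>A. (cmod (c i))\<^sup>2)"
  using assms(2)
proof (induction A rule: finite_induct)
  case (insert j A)
  have "cinner (c j *\<^sub>C e j) (\<Sum>i\<in>A. c i *\<^sub>C e i) = 0"
    using insert.hyps assms(1)
    by (auto simp: cinner_sum_right cinner_scaleC_left cinner_scaleC_right orthonormal_sequence_def
        intro!: sum.neutral)
  moreover have "(norm (c j *\<^sub>C e j))\<^sup>2 = (cmod (c j))\<^sup>2"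
  proof -
    have "complex_of_real ((norm (e j))\<^sup>2) = 1"
      using assms(1) unfolding cinner_self[symmetric] by (simp add: orthonormal_sequence_def)
    then have "(norm (e j))\<^sup>2 = 1" by (simp only: of_real_eq_1_iff)
    then show ?thesis by (simp add: norm_scaleC power_mult_distrib)
  qed
  ultimately show ?case
    using insert by (simp add: norm_add_square)
qed simp

text \<open>The remainder of a Fourier partial sum is orthogonal to the partial sum.  This one identity yields
  both Bessel's inequality and the fact that remainders are no longer than \<open>f\<close>.\<close>

lemma norm_fourier_remainder_square:
  assumes "orthonormal_sequence e"
  shows "(norm (f - (\<Sum>m<n. cinner f (e m) *\<^sub>C e m)))\<^sup>2
    = (norm f)\<^sup>2 - (\<Sum>m<n. (cmod (cinner f (e m)))\<^sup>2)"
proof -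
  define p where "p = (\<Sum>m<n. cinner f (e m) *\<^sub>C e m)"
  have p: "(norm p)\<^sup>2 = (\<Sum>m<n. (cmod (cinner f (e m)))\<^sup>2)"
    unfolding p_def by (rule norm_sum_orthonormal_square[OF assms]) simp
  have "cinner f p = of_real ((norm p)\<^sup>2)"
    unfolding p
    by (simp add: p_def cinner_sum_right cinner_scaleC_right complex_norm_square mult.commute
        del: of_real_power)
  then have "cinner (f - p) p = 0"
    by (simp add: cinner_diff_left cinner_self)
  then have "(norm ((f - p) + p))\<^sup>2 = (norm (f - p))\<^sup>2 + (norm p)\<^sup>2"
    unfolding norm_add_square by simp
  then show ?thesis
    by (simp add: p flip: p_def)
qed

lemma bessel_inequality:
  assumes "orthonormal_sequence e"
  shows "(\<Sum>m<n. (cmod (cinner f (e m)))\<^sup>2) \<le> (norm f)\<^sup>2"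
  using norm_fourier_remainder_square[OF assms, of f n] by (metis diff_ge_0_iff_ge zero_le_power2)

text \<open>The remainders are linear in \<open>f\<close> and bounded in norm by \<open>\<parallel>f\<parallel>\<close>, uniformly in their index, so the
  vectors whose remainders tend to zero form a closed subspace; it contains the basis.\<close>

lemma fourier_expansion:
  assumes "orthonormal_basis e"
  shows "(\<lambda>m. cinner f (e m) *\<^sub>C e m) sums f"
proof -
  have on: "orthonormal_sequence e"
    using assms by (simp add: orthonormal_basis_def orthonormal_sequence_def)
  define P where "P n f = (\<Sum>m<n. cinner f (e m) *\<^sub>C e m)" for n f
  have P_add: "P n (x + y) = P n x + P n y" for n x y
    by (simp add: P_def cinner_add_left complex_vector.scale_left_distrib sum.distrib)
  have P_scale: "P n (c *\<^sub>C x) = c *\<^sub>C P n x" for n c x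
    by (simp add: P_def cinner_scaleC_left complex_vector.scale_sum_right)
  have P_contr: "norm (f - P n f) \<le> norm f" for n f
  proof (rule power2_le_imp_le)
    show "(norm (f - P n f))\<^sup>2 \<le> (norm f)\<^sup>2"
      unfolding P_def norm_fourier_remainder_square[OF on] by (simp add: sum_nonneg)
  qed simp
  have span: "(\<lambda>n. g - P n g) \<longlonglongrightarrow> 0" if "g \<in> complex_vector.span (range e)" for g
    using that
  proof (induction rule: complex_vector.span_induct_alt)
    case base
    show ?case by (simp add: P_def)
  next
    case (step c x y)
    then obtain k where x: "x = e k" by auto
    have "P n x = x" if "n > k" for n
    proof -
      have "P n x = (\<Sum>m<n. if m = k then e k else 0)"
        unfolding P_def using on
        by (intro sum.cong) (auto simp: x orthonormal_sequence_def)
      then show ?thesis using that x by simp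
    qed
    then have "\<forall>\<^sub>F n in sequentially. y - P n y = (c *\<^sub>C x + y) - P n (c *\<^sub>C x + y)"
      by (intro eventually_sequentiallyI[of "Suc k"]) (simp add: P_add P_scale)
    with step(2) show ?case
      by (rule Lim_transform_eventually)
  qed
  have "(\<lambda>n. f - P n f) \<longlonglongrightarrow> 0"
  proof (rule LIMSEQ_I)
    fix r :: real assume "r > 0"
    have "f \<in> closure (complex_vector.span (range e))"
      using assms by (simp add: orthonormal_basis_def)
    then obtain g where g: "g \<in> complex_vector.span (range e)" "dist g f < r / 2"
      using \<open>r > 0\<close> unfolding closure_approachable by (meson half_gt_zero)
    obtain N where N: "norm (g - P n g) < r / 2" if "n \<ge> N" for n
      using LIMSEQ_D[OF span[OF g(1)], of "r / 2"] \<open>r > 0\<close> by auto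
    have "norm (f - P n f - 0) < r" if "n \<ge> N" for n
    proof -
      have "f - P n f = ((f - g) - P n (f - g)) + (g - P n g)"
        using P_add[of n "f - g" g] by simp
      then have "norm (f - P n f) \<le> norm ((f - g) - P n (f - g)) + norm (g - P n g)"
        by (metis norm_triangle_ineq)
      also have "\<dots> < r / 2 + r / 2"
        using P_contr[of "f - g" n] N[OF that] g(2)
        by (simp add: dist_norm norm_minus_commute)
      finally show ?thesis by simp
    qed
    then show "\<exists>no. \<forall>n\<ge>no. norm (f - P n f - 0) < r" by blast
  qed
  then have "(\<lambda>n. f - (f - P n f)) \<longlonglongrightarrow> f - 0"
    by (intro tendsto_diff tendsto_const)
  then show ?thesis
    by (simp add: sums_def P_def)
qed

lemma parseval_identity:
  assumes "orthonormal_basis e"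
  shows "(\<lambda>m. (cmod (cinner f (e m)))\<^sup>2) sums (norm f)\<^sup>2"
proof -
  have on: "orthonormal_sequence e"
    using assms by (simp add: orthonormal_basis_def orthonormal_sequence_def)
  have "(\<lambda>n. (norm (\<Sum>m<n. cinner f (e m) *\<^sub>C e m))\<^sup>2) \<longlonglongrightarrow> (norm f)\<^sup>2"
    using fourier_expansion[OF assms, of f] unfolding sums_def
    by (intro tendsto_power tendsto_norm)
  then show ?thesis
    by (simp add: sums_def norm_sum_orthonormal_square[OF on])
qed

instance chilbert_space \<subseteq> banach ..

lemma riesz_fischer:
  fixes e :: "nat \<Rightarrow> 'a::chilbert_space"
  assumes on: "orthonormal_sequence e" and c: "summable (\<lambda>m. (cmod (c m))\<^sup>2)"
  shows "summable (\<lambda>m. c m *\<^sub>C e m)"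
  unfolding summable_Cauchy
proof (intro allI impI)
  fix r :: real assume "r > 0"
  then obtain N where N: "norm (\<Sum>i\<in>{m..<n}. (cmod (c i))\<^sup>2) < r\<^sup>2" if "m \<ge> N" for m n
    using c[unfolded summable_Cauchy, rule_format, of "r\<^sup>2"] by auto
  have "norm (\<Sum>i\<in>{m..<n}. c i *\<^sub>C e i) < r" if "m \<ge> N" for m n
  proof (rule power_less_imp_less_base)
    show "(norm (\<Sum>i\<in>{m..<n}. c i *\<^sub>C e i))\<^sup>2 < r\<^sup>2"
      using N[OF that, of n] by (simp add: norm_sum_orthonormal_square[OF on])
  qed (use \<open>r > 0\<close> in simp)
  then show "\<exists>N. \<forall>m\<ge>N. \<forall>n. norm (\<Sum>i\<in>{m..<n}. c i *\<^sub>C e i) < r" by blast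
qed

section \<open>Isometries and their adjoints\<close>

text \<open>The relation \<open>S = W\<^sup>*\<close> for an isometry \<open>W\<close>, stated through inner products.  Linearity and
  boundedness of both maps follow from it, and it is visibly closed under composition.\<close>

definition isometry_adjoint_pair :: "('a::complex_inner \<Rightarrow> 'a) \<Rightarrow> ('a \<Rightarrow> 'a) \<Rightarrow> bool" where
  "isometry_adjoint_pair W S \<longleftrightarrow>
     (\<forall>x y. cinner (W x) (W y) = cinner x y) \<and> (\<forall>x y. cinner (W x) y = cinner x (S y))"

context
  fixes W S :: "'a::complex_inner \<Rightarrow> 'a"
  assumes pair: "isometry_adjoint_pair W S"
begin

lemma pair_isometry: "cinner (W x) (W y) = cinner x y"
  and pair_adjoint: "cinner (W x) y = cinner x (S y)"
  using pair by (auto simp: isometry_adjoint_pair_def)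

lemma pair_norm: "norm (W x) = norm x"
  by (simp add: norm_eq_sqrt_cinner pair_isometry)

lemma pair_left_inverse: "S (W x) = x"
  by (rule cinner_right_cancel) (simp add: pair_isometry flip: pair_adjoint)

lemma pair_adjoint_add: "S (x + y) = S x + S y"
  by (rule cinner_right_cancel) (simp add: cinner_add_right flip: pair_adjoint)

lemma pair_adjoint_scaleC: "S (c *\<^sub>C x) = c *\<^sub>C S x"
  by (rule cinner_right_cancel) (simp add: cinner_scaleC_right flip: pair_adjoint)

lemma pair_adjoint_norm_le: "norm (S y) \<le> norm y"
proof (cases "S y = 0")
  case False
  have "(norm (S y))\<^sup>2 = cmod (cinner (S y) (S y))"
    unfolding cinner_self by (simp add: norm_power)
  also have "\<dots> = cmod (cinner (W (S y)) y)"
    by (simp add: pair_adjoint)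
  also have "\<dots> \<le> norm (S y) * norm y"
    using cinner_Cauchy_Schwarz[of "W (S y)" y] by (simp add: pair_norm)
  finally show ?thesis
    using False by (simp add: power2_eq_square)
qed simp

lemma pair_bounded_linear_adjoint: "bounded_linear S"
  by (rule bounded_linear_intro[where K = 1])
    (simp_all add: pair_adjoint_add scaleR_scaleC pair_adjoint_scaleC pair_adjoint_norm_le)

end

lemma isometry_adjoint_pair_comp:
  assumes "isometry_adjoint_pair W S" "isometry_adjoint_pair W' S'"
  shows "isometry_adjoint_pair (W' \<circ> W) (S \<circ> S')"
  using assms unfolding isometry_adjoint_pair_def comp_apply by metis

lemma isometry_adjoint_pair_id: "isometry_adjoint_pair id id"
  by (simp add: isometry_adjoint_pair_def)

lemma isometry_adjoint_pair_scaleC: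
  assumes "isometry_adjoint_pair W S" and "cmod \<tau> = 1"
  shows "isometry_adjoint_pair (\<lambda>x. cnj \<tau> *\<^sub>C W x) (\<lambda>x. \<tau> *\<^sub>C S x)"
proof -
  have "\<tau> * cnj \<tau> = 1"
    using assms(2) complex_norm_square[of \<tau>] by simp
  then show ?thesis
    by (simp add: isometry_adjoint_pair_def cinner_scaleC_left cinner_scaleC_right
        pair_isometry[OF assms(1)] mult.commute[of "cnj \<tau>"] flip: mult.assoc)
      (simp add: pair_adjoint[OF assms(1)])
qed

lemma hilbert_isometry_add: "hilbert_isometry V \<Longrightarrow> V (x + y) = V x + V y"
  and hilbert_isometry_scaleC: "hilbert_isometry V \<Longrightarrow> V (c *\<^sub>C x) = c *\<^sub>C V x"
  by (auto simp: hilbert_isometry_def linear_iff_module_hom module_hom_iff)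

text \<open>Polarization; the imaginary part is read off from the real part after replacing \<open>x\<close> by \<open>\<i> x\<close>.\<close>

lemma hilbert_isometry_cinner:
  assumes "hilbert_isometry V"
  shows "cinner (V x) (V y) = cinner x y"
proof -
  have norm_V: "norm (V x) = norm x" for x
    using assms by (simp add: hilbert_isometry_def)
  have Re_eq: "Re (cinner (V x) (V y)) = Re (cinner x y)" for x y
    using norm_V[of "x + y"] norm_add_square[of "V x" "V y"] norm_add_square[of x y]
    by (simp add: hilbert_isometry_add[OF assms] norm_V)
  have "Im (cinner (V x) (V y)) = Im (cinner x y)"
    using Re_eq[of "\<i> *\<^sub>C x" y] by (simp add: hilbert_isometry_scaleC[OF assms] cinner_scaleC_left)
  with Re_eq show ?thesis by (simp add: complex_eq_iff)
qed

text \<open>An orthonormal basis gives the adjoint explicitly; its defining series converges by Bessel's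
  inequality for the orthonormal sequence \<open>V \<circ> e\<close>.  This makes the definite description in
  \<^const>\<open>cadjoint\<close> meaningful.\<close>

lemma hilbert_isometry_cadjoint_pair:
  fixes V :: "'a::chilbert_space \<Rightarrow> 'a" and e :: "nat \<Rightarrow> 'a"
  assumes V: "hilbert_isometry V" and e: "orthonormal_basis e"
  shows "isometry_adjoint_pair V (cadjoint V)"
proof -
  have on: "orthonormal_sequence e"
    using e by (simp add: orthonormal_basis_def orthonormal_sequence_def)
  then have onV: "orthonormal_sequence (\<lambda>m. V (e m))"
    by (simp add: orthonormal_sequence_def hilbert_isometry_cinner[OF V])
  define S where "S y = (\<Sum>m. cinner y (V (e m)) *\<^sub>C e m)" for y
  have S: "(\<lambda>m. cinner y (V (e m)) *\<^sub>C e m) sums S y" for y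
    unfolding S_def
    by (intro summable_sums riesz_fischer[OF on] summableI_nonneg_bounded[OF _ bessel_inequality[OF onV]]) simp
  have blV: "bounded_linear V"
    using V by (intro bounded_linear_intro[where K = 1])
      (simp_all add: hilbert_isometry_add hilbert_isometry_scaleC scaleR_scaleC hilbert_isometry_def)
  have adj: "cinner (V x) y = cinner x (S y)" for x y
  proof (rule sums_unique2)
    have "(\<lambda>m. cinner (V (cinner x (e m) *\<^sub>C e m)) y) sums cinner (V x) y"
      by (intro bounded_linear.sums[OF bounded_linear_cinner_left] bounded_linear.sums[OF blV]
          fourier_expansion[OF e])
    moreover have "cinner (V (cinner x (e m) *\<^sub>C e m)) y = cinner x (cinner y (V (e m)) *\<^sub>C e m)" for m
      using cinner_commute[of "V (e m)" y]
      by (simp add: hilbert_isometry_scaleC[OF V] cinner_scaleC_left cinner_scaleC_right)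
    ultimately show "(\<lambda>m. cinner x (cinner y (V (e m)) *\<^sub>C e m)) sums cinner (V x) y" by simp
    show "(\<lambda>m. cinner x (cinner y (V (e m)) *\<^sub>C e m)) sums cinner x (S y)"
      by (rule bounded_linear.sums[OF bounded_linear_cinner_right S])
  qed
  have "cadjoint V = S"
    unfolding cadjoint_def
  proof (rule the_equality)
    fix S' assume "\<forall>x y. cinner (V x) y = cinner x (S' y)"
    then show "S' = S"
      by (intro ext cinner_right_cancel) (simp flip: adj)
  qed (simp add: adj)
  then show ?thesis
    using adj hilbert_isometry_cinner[OF V] unfolding isometry_adjoint_pair_def by metis
qed

section \<open>Blaschke operators\<close>

text \<open>Solving \<open>y + c T y = z\<close> means finding the fixed point of the strict contraction
  \<open>y \<mapsto> z - c T y\<close>.\<close>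

lemma bij_id_plus_contraction:
  fixes T :: "'a::chilbert_space \<Rightarrow> 'a"
  assumes add: "\<And>x y. T (x + y) = T x + T y" and contr: "\<And>x. norm (T x) \<le> norm x"
    and c: "cmod c < 1"
  shows "bij (\<lambda>y. y + c *\<^sub>C T y)"
proof -
  have diff: "T x - T y = T (x - y)" for x y
    using add[of "x - y" y] by simp
  have "\<exists>!y. z - c *\<^sub>C T y = y" for z
  proof (rule banach_fix_type[where c = "cmod c"], safe)
    fix x y
    have "dist (z - c *\<^sub>C T x) (z - c *\<^sub>C T y) = norm (c *\<^sub>C T (y - x))"
      by (simp add: dist_norm complex_vector.scale_right_diff_distrib flip: diff)
    also have "\<dots> \<le> cmod c * norm (y - x)"
      by (simp add: norm_scaleC mult_left_mono contr)
    finally show "dist (z - c *\<^sub>C T x) (z - c *\<^sub>C T y) \<le> cmod c * dist x y"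
      by (simp add: dist_norm norm_minus_commute)
  qed (use c in simp_all)
  then have "\<exists>!y. z = y + c *\<^sub>C T y" for z
    by (simp add: algebra_simps)
  then show ?thesis
    by (subst bij_iff) (metis)
qed

text \<open>With \<open>T = V\<^sup>*\<close>, \<open>x = u + l V u\<close> and \<open>y = w + cnj l T w\<close>, the claims become identities
  between the sesquilinear expressions in \<open>u\<close>, \<open>V u\<close> and \<open>w\<close>, \<open>T w\<close>.\<close>

lemma blaschke_factor_pair:
  fixes V T :: "'a::chilbert_space \<Rightarrow> 'a"
  assumes V: "hilbert_isometry V" and VT: "isometry_adjoint_pair V T" and l: "cmod l < 1"
  shows "isometry_adjoint_pair
    ((\<lambda>u. V u + cnj l *\<^sub>C u) \<circ> inv (\<lambda>u. u + l *\<^sub>C V u))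
    ((\<lambda>y. T y + l *\<^sub>C y) \<circ> inv (\<lambda>y. y + cnj l *\<^sub>C T y))"
proof -
  define M where "M = (\<lambda>u. u + l *\<^sub>C V u)"
  define L where "L = (\<lambda>y. y + cnj l *\<^sub>C T y)"
  have M: "bij M"
    unfolding M_def using l
    by (intro bij_id_plus_contraction) (simp_all add: hilbert_isometry_add[OF V] pair_norm[OF VT])
  have L: "bij L"
    unfolding L_def using l
    by (intro bij_id_plus_contraction) (simp_all add: pair_adjoint_add[OF VT] pair_adjoint_norm_le[OF VT])
  note expand = cinner_add_left cinner_add_right cinner_scaleC_left cinner_scaleC_right
    pair_adjoint[OF VT] pair_left_inverse[OF VT] algebra_simps
  have "cinner (V u + cnj l *\<^sub>C u) (V v + cnj l *\<^sub>C v) = cinner (M u) (M v)" for u v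
    by (simp add: M_def expand)
  then have iso: "cinner (V (inv M x) + cnj l *\<^sub>C inv M x) (V (inv M y) + cnj l *\<^sub>C inv M y) = cinner x y" for x y
    using M by (simp add: bij_is_surj surj_f_inv_f)
  have "cinner (V u + cnj l *\<^sub>C u) (L w) = cinner (M u) (T w + l *\<^sub>C w)" for u w
    by (simp add: M_def L_def expand)
  then have "cinner (V (inv M x) + cnj l *\<^sub>C inv M x) (L (inv L y))
      = cinner (M (inv M x)) (T (inv L y) + l *\<^sub>C inv L y)" for x y .
  then have adj: "cinner (V (inv M x) + cnj l *\<^sub>C inv M x) y = cinner x (T (inv L y) + l *\<^sub>C inv L y)" for x y
    using M L by (simp add: bij_is_surj surj_f_inv_f)
  show ?thesis
    unfolding M_def[symmetric] L_def[symmetric] isometry_adjoint_pair_def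
    using iso adj by simp
qed

lemma op_prod_pair:
  assumes "\<And>j. j \<in> {1..d} \<Longrightarrow> \<exists>W. isometry_adjoint_pair W (F j)"
  shows "\<exists>W. isometry_adjoint_pair W (op_prod F d)"
  using assms
proof (induction d)
  case 0
  show ?case using isometry_adjoint_pair_id by (metis op_prod.simps(1))
next
  case (Suc d)
  obtain W where "isometry_adjoint_pair W (op_prod F d)"
    using Suc by force
  moreover obtain W' where "isometry_adjoint_pair W' (F (Suc d))"
    using Suc.prems[of "Suc d"] by auto
  ultimately show ?case
    unfolding op_prod.simps using isometry_adjoint_pair_comp by blast
qed

lemma blaschke_operator_pair:
  fixes V T :: "'a::chilbert_space \<Rightarrow> 'a"
  assumes "hilbert_isometry V" and "isometry_adjoint_pair V T" and "cmod \<tau> = 1"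
    and "\<And>j. j \<in> {1..d} \<Longrightarrow> cmod (lam j) < 1"
  shows "\<exists>W. isometry_adjoint_pair W (blaschke_operator \<tau> d lam T)"
proof -
  obtain W where "isometry_adjoint_pair W
      (op_prod (\<lambda>j. (\<lambda>y. T y + lam j *\<^sub>C y) \<circ> inv (\<lambda>y. y + cnj (lam j) *\<^sub>C T y)) d)"
    using op_prod_pair blaschke_factor_pair[OF assms(1,2)] assms(4) by meson
  from isometry_adjoint_pair_scaleC[OF this assms(3)] show ?thesis
    by (auto simp: blaschke_operator_def[abs_def])
qed

section \<open>Images of orthonormal bases under adjoints of isometries\<close>

lemma parseval_coisometry_image:
  assumes WS: "isometry_adjoint_pair W S" and e: "orthonormal_basis e"
  shows "(\<lambda>m. (cmod (cinner f (S (e m))))\<^sup>2) sums (norm f)\<^sup>2"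
  using parseval_identity[OF e, of "W f"]
  by (simp add: pair_adjoint[OF WS] pair_norm[OF WS])

lemma reconstruction_coisometry_image:
  assumes WS: "isometry_adjoint_pair W S" and e: "orthonormal_basis e"
  shows "(\<lambda>m. cinner f (S (e m)) *\<^sub>C S (e m)) sums f"
  using bounded_linear.sums[OF pair_bounded_linear_adjoint[OF WS] fourier_expansion[OF e, of "W f"]]
  by (simp add: pair_adjoint[OF WS] pair_adjoint_scaleC[OF WS] pair_left_inverse[OF WS])

theorem theorem3p5:
  fixes V :: "'a::chilbert_space \<Rightarrow> 'a"
    and b :: "nat \<Rightarrow> 'a"
    and \<tau> :: complex and d :: nat and lam :: "nat \<Rightarrow> complex"
  assumes "\<not> cfinite_dimensional TYPE('a)"
    and "separable_space (euclidean :: 'a topology)"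
    and "cmod \<tau> = 1"
    and "\<And>j. j \<in> {1..d} \<Longrightarrow> lam j \<in> ball 0 1"
    and "hilbert_isometry V"
    and "blaschke_frame \<tau> d lam V b"
  shows "parseval_frame b \<and> frame_operator b = id \<and>
         (\<forall>f. (\<lambda>m. cinner f (b m) *\<^sub>C b m) sums f)"
proof -
  obtain e where e: "orthonormal_basis e"
    and b: "\<And>m. b m = blaschke_operator \<tau> d lam (cadjoint V) (e m)"
    using assms(6) by (auto simp: blaschke_frame_def)
  have "cmod (lam j) < 1" if "j \<in> {1..d}" for j
    using assms(4)[OF that] by simp
  then obtain W where W: "isometry_adjoint_pair W (blaschke_operator \<tau> d lam (cadjoint V))"
    using blaschke_operator_pair[OF assms(5) hilbert_isometry_cadjoint_pair[OF assms(5) e] assms(3)]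
    by blast
  have "(\<lambda>m. (cmod (cinner f (b m)))\<^sup>2) sums (norm f)\<^sup>2" for f
    unfolding b by (rule parseval_coisometry_image[OF W e])
  then have "frame_bounds 1 1 b"
    by (simp add: frame_bounds_def sums_iff)
  then have "parseval_frame b"
    unfolding parseval_frame_def hilbert_frame_def using zero_less_one by blast
  moreover have rec: "(\<lambda>m. cinner f (b m) *\<^sub>C b m) sums f" for f
    unfolding b by (rule reconstruction_coisometry_image[OF W e])
  moreover have "frame_operator b = id"
    using rec by (auto simp: frame_operator_def sums_iff)
  ultimately show ?thesis by simp
qed

end
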